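(* Let $A$ be a real symmetric $n\times n$ matrix with eigenvalues $\lambda_1\geq\cdots\geq\lambda_n$, listed with multiplicity. If every negative eigenvalue of $A$ has even multiplicity (i.e. appears an even number of times in the list $\lambda_1,\ldots,\lambda_n$), then $A$ has a real root, i.e. there exists a real $n\times n$ matrix $R$ such that $R^2=A$.
   Context: A matrix $R$ is called a root of $A$ if $A=R^2$; a real root is a root with real entries. The root is not required to be symmetric. *)

theory Defs
  imports "Jordan_Normal_Form.Char_Poly"
begin

text \<open>
  The real roots of the characteristic polynomial, each repeated as often as its
  multiplicity as a root, in decreasing order. For a real symmetric matrix all complex
  eigenvalues are real, so this is the complete list of its eigenvalues.
\<close>

definition eigenvalue_list :: "real mat \<Rightarrow> real list" where
  "eigenvalue_list A = rev (sorted_list_of_multiset (proots (char_poly A)))"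

definition matrix_root :: "'a :: semiring_1 mat \<Rightarrow> 'a mat \<Rightarrow> bool" where
  "matrix_root R A \<longleftrightarrow> square_mat R \<and> A = R ^\<^sub>m 2"

lemma sorted_eigenvalue_list: "sorted_wrt (\<ge>) (eigenvalue_list A)"
  by (simp add: eigenvalue_list_def sorted_wrt_rev)

lemma count_list_eigenvalue_list:
  assumes "A \<in> carrier_mat n n"
  shows "count_list (eigenvalue_list A) x = order x (char_poly A)"
proof -
  have "char_poly A \<noteq> 0"
    using degree_monic_char_poly[OF assms] by auto
  then show ?thesis
    by (simp add: eigenvalue_list_def flip: count_mset)
qed

lemma set_eigenvalue_list:
  assumes "A \<in> carrier_mat n n"
  shows "x \<in> set (eigenvalue_list A) \<longleftrightarrow> eigenvalue A x"
proof -
  have "char_poly A \<noteq> 0"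
    using degree_monic_char_poly[OF assms] by auto
  then show ?thesis
    by (simp add: eigenvalue_list_def eigenvalue_root_char_poly[OF assms])
qed

end

theory Submission
  imports Defs "Jordan_Normal_Form.Schur_Decomposition"
begin

text \<open>
  A real symmetric matrix is orthogonally diagonalizable with its eigenvalues in any
  prescribed order. Arrange them so that equal negative eigenvalues come in adjacent pairs.
  The diagonal matrix then has a block diagonal root: a nonnegative eigenvalue \<open>x\<close> contributes
  the block \<open>sqrt x\<close>, and a pair of negative eigenvalues \<open>x, x\<close> contributes a rotation by a
  right angle scaled by \<open>sqrt (- x)\<close>, whose square is \<open>x\<close> times the identity.
\<close>

section \<open>Orthogonal diagonalization of real symmetric matrices\<close>

text \<open>Complete \<open>v\<close> to a basis, apply Gram-Schmidt, which keeps the first vector,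
  and normalize. The value of \<open>c\<close> is irrelevant later: a multiple of an eigenvector
  suffices as first column.\<close>

lemma orthogonal_mat_with_first_col:
  fixes v :: "real vec"
  assumes v: "v \<in> carrier_vec n" and v0: "v \<noteq> 0\<^sub>v n"
  obtains Q c where "Q \<in> carrier_mat n n" "Q\<^sup>T * Q = 1\<^sub>m n" "col Q 0 = c \<cdot>\<^sub>v v"
proof -
  interpret cof_vec_space n "TYPE(real)" .
  define b where "b = basis_completion v"
  note bas = basis_completion[OF v v0, folded b_def]
  define ws where "ws = gram_schmidt n b"
  note gs = gram_schmidt_result[OF bas(2) bas(4) bas(5) ws_def]
  have n: "n \<noteq> 0"
  proof
    assume "n = 0"
    then have "v = 0\<^sub>v n" using v by auto
    with v0 show False by simp
  qed
  have len: "length ws = n" using gs(4) bas(6) by simp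
  obtain vs where "b = v # vs" using bas(6,7) n by (cases b) auto
  then have "hd ws = v" using v by (simp add: ws_def)
  then have ws0: "ws ! 0 = v" using len n by (cases ws) auto
  have wsc: "ws ! i \<in> carrier_vec n" if "i < n" for i
    using gs(3) len that nth_mem by blast
  \<comment> \<open>Conjugation is trivial over the reals, so this is ordinary orthogonality. The
    case \<open>i = j\<close> also says that no vector has norm zero, so normalizing is
    legitimate.\<close>
  have orth: "ws ! i \<bullet> ws ! j = 0 \<longleftrightarrow> i \<noteq> j" if "i < n" "j < n" for i j
    using corthogonalD[OF gs(2), of i j] that len by simp
  define f where "f w = (1 / sqrt (w \<bullet> w)) \<cdot>\<^sub>v w" for w :: "real vec"
  define Q where "Q = mat_of_cols n (map f ws)"
  have colQ: "col Q i = f (ws ! i)" if "i < n" for i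
    unfolding Q_def using that len wsc[OF that] by (subst col_mat_of_cols) (auto simp: f_def)
  have Q: "Q \<in> carrier_mat n n" unfolding Q_def using len by auto
  have "Q\<^sup>T * Q = 1\<^sub>m n"
  proof (rule eq_matI, goal_cases)
    case (1 i j)
    then have ij: "i < n" "j < n" by auto
    have "(Q\<^sup>T * Q) $$ (i, j) = f (ws ! i) \<bullet> f (ws ! j)"
      using ij Q by (simp add: colQ)
    also have "\<dots> = (ws ! i \<bullet> ws ! j) / (sqrt (ws ! i \<bullet> ws ! i) * sqrt (ws ! j \<bullet> ws ! j))"
      using wsc[OF ij(1)] wsc[OF ij(2)] by (auto simp: f_def)
    also have "\<dots> = 1\<^sub>m n $$ (i, j)"
    proof (cases "i = j")
      case True
      have "ws ! i \<bullet> ws ! i \<ge> 0"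
        using conjugate_square_ge_0_vec[of "ws ! i"] by simp
      moreover have "ws ! i \<bullet> ws ! i \<noteq> 0" using orth ij by auto
      ultimately show ?thesis using True ij by simp
    qed (use orth ij in simp)
    finally show ?case .
  qed (use Q in auto)
  moreover have "col Q 0 = (1 / sqrt (v \<bullet> v)) \<cdot>\<^sub>v v"
    using colQ[of 0] n ws0 by (simp add: f_def)
  ultimately show ?thesis using that Q by blast
qed

text \<open>Over the complex numbers the polynomial splits, and symmetry forces every root to be
  real. The factorization then descends, since the embedding of real polynomials is
  injective.\<close>

lemma real_symmetric_char_poly_splits:
  fixes A :: "real mat"
  assumes A: "A \<in> carrier_mat n n" and sym: "A\<^sup>T = A"
  shows "\<exists>es. char_poly A = (\<Prod>e\<leftarrow>es. [:- e, 1:])"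
proof -
  define C where "C = map_mat complex_of_real A"
  have C: "C \<in> carrier_mat n n" using A by (simp add: C_def)
  have Csym: "C\<^sup>T = C" using sym by (simp add: C_def map_mat_transpose)
  interpret hp: map_poly_inj_comm_ring_hom complex_of_real ..
  obtain as where as: "char_poly C = (\<Prod>a\<leftarrow>as. [:- a, 1:])"
    using char_poly_factorized[OF C] by blast
  have real: "cnj a = a" if "a \<in> set as" for a
  proof -
    have "poly (char_poly C) a = 0"
      using that unfolding as by (induction as) auto
    then obtain v where v: "v \<in> carrier_vec n" "v \<noteq> 0\<^sub>v n" "C *\<^sub>v v = a \<cdot>\<^sub>v v"
      using eigenvalue_root_char_poly[OF C] C by (auto simp: eigenvalue_def eigenvector_def)
    let ?w = "conjugate v"
    have w: "?w \<in> carrier_vec n" using v by simp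
    \<comment> \<open>The entries of \<open>C\<close> are real, so conjugation passes through
      it.\<close>
    have "C *\<^sub>v ?w = conjugate (C *\<^sub>v v)"
      using A v(1) by (intro eq_vecI) (auto simp: C_def scalar_prod_def)
    also have "\<dots> = cnj a \<cdot>\<^sub>v ?w"
      by (simp add: v(3) conjugate_smult_vec)
    finally have Cw: "C *\<^sub>v ?w = cnj a \<cdot>\<^sub>v ?w" .
    \<comment> \<open>The product here is bilinear, so \<open>C\<close> moves across it by symmetry.
      Cancelling \<open>v \<bullet> ?w\<close>, which is nonzero because \<open>v\<close> is, leaves
      \<open>cnj a = a\<close>.\<close>
    have "a * (v \<bullet> ?w) = (C\<^sup>T *\<^sub>v v) \<bullet> ?w"
      using v w Csym by simp
    also have "\<dots> = v \<bullet> (C *\<^sub>v ?w)"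
      by (rule transpose_vec_mult_scalar[OF C w v(1)])
    also have "\<dots> = cnj a * (v \<bullet> ?w)" using v w by (simp add: Cw)
    finally show ?thesis using v by simp
  qed
  define es where "es = map Re as"
  have "as = map complex_of_real es"
    unfolding es_def using real by (auto simp: complex_eq_iff intro!: nth_equalityI)
  then have "char_poly C = map_poly complex_of_real (\<Prod>e\<leftarrow>es. [:- e, 1:])"
    unfolding as by (simp add: hp.hom_prod_list o_def)
  then have "map_poly complex_of_real (char_poly A)
      = map_poly complex_of_real (\<Prod>e\<leftarrow>es. [:- e, 1:])"
    unfolding C_def of_real_hom.char_poly_hom[OF A] .
  then show ?thesis by (auto simp: hp.injectivity)
qed

lemma mat_diag_nth_append:
  "mat_diag (length (xs @ ys)) ((!) (xs @ ys)) =
    four_block_mat (mat_diag (length xs) ((!) xs)) (0\<^sub>m (length xs) (length ys))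
      (0\<^sub>m (length ys) (length xs)) (mat_diag (length ys) ((!) ys))"
  by (rule eq_matI) (auto simp: mat_diag_def nth_append)

text \<open>Deflation: an orthogonal change of basis splits off the eigenvalue at the head of the
  list and leaves a smaller symmetric block for the induction. The order of \<open>es\<close> is
  arbitrary, which later allows equal negative eigenvalues to be paired.\<close>

lemma real_symmetric_similar_diag:
  fixes A :: "real mat"
  assumes "A \<in> carrier_mat n n" and "A\<^sup>T = A"
    and "char_poly A = (\<Prod>e\<leftarrow>es. [:- e, 1:])"
  shows "length es = n \<and> similar_mat A (mat_diag n ((!) es))"
  using assms
proof (induction es arbitrary: A n)
  case Nil
  then have "n = 0" using degree_monic_char_poly[OF Nil(1)] by simp
  then have "mat_diag n ((!) []) = A" using Nil(1) by (intro eq_matI) (auto simp: mat_diag_def)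
  then show ?case using \<open>n = 0\<close> similar_mat_refl[OF Nil(1)] by simp
next
  case (Cons e es)
  note A = Cons.prems(1)
  have "eigenvalue A e"
    unfolding eigenvalue_root_char_poly[OF A] Cons.prems(3) by simp
  then obtain v where v: "v \<in> carrier_vec n" "v \<noteq> 0\<^sub>v n" "A *\<^sub>v v = e \<cdot>\<^sub>v v"
    using A by (auto simp: eigenvalue_def eigenvector_def)
  have "n \<noteq> 0" using eigenvalue_imp_nonzero_dim[OF A \<open>eigenvalue A e\<close>] by simp
  then obtain m where n: "n = Suc m" by (cases n) auto
  obtain Q c where Q: "Q \<in> carrier_mat n n" "Q\<^sup>T * Q = 1\<^sub>m n" "col Q 0 = c \<cdot>\<^sub>v v"
    using orthogonal_mat_with_first_col[OF v(1,2)] .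
  have Qt: "Q\<^sup>T \<in> carrier_mat n n" using Q by simp
  have QQt: "Q * Q\<^sup>T = 1\<^sub>m n" using mat_mult_left_right_inverse[OF Qt Q(1,2)] .
  define B where "B = Q\<^sup>T * A * Q"
  have B: "B \<in> carrier_mat n n" using A Q by (simp add: B_def)
  have simBA: "similar_mat B A"
    by (rule similar_matI[of _ _ "Q\<^sup>T" Q n]) (use A B Q Qt QQt in \<open>auto simp: B_def\<close>)
  have Bsym: "B\<^sup>T = B"
  proof -
    have "B\<^sup>T = Q\<^sup>T * (Q\<^sup>T * A)\<^sup>T"
      unfolding B_def using A Q Qt by (intro transpose_mult[of _ n n _ n]) auto
    also have "(Q\<^sup>T * A)\<^sup>T = A * Q"
      using transpose_mult[OF Qt A] Cons.prems(2) by simp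
    also have "Q\<^sup>T * (A * Q) = B"
      unfolding B_def by (rule assoc_mult_mat[OF Qt A Q(1), symmetric])
    finally show ?thesis .
  qed
  \<comment> \<open>The first column of \<open>Q\<close> is sent by \<open>A\<close> to
    \<open>e\<close> times itself, and \<open>Q\<^sup>T\<close> takes it to the first unit vector.
    Symmetry of \<open>B\<close> then settles the first row as well.\<close>
  have "col B 0 = (Q\<^sup>T * A) *\<^sub>v col Q 0"
    unfolding B_def using n by (intro col_mult2[of _ n n _ n]) (use A Q in auto)
  also have "\<dots> = Q\<^sup>T *\<^sub>v (A *\<^sub>v (c \<cdot>\<^sub>v v))"
    unfolding Q(3) using A Q v by (intro assoc_mult_mat_vec[of _ n n]) auto
  also have "A *\<^sub>v (c \<cdot>\<^sub>v v) = e \<cdot>\<^sub>v col Q 0"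
    unfolding Q(3) using A v by (simp add: mult_mat_vec[of _ n n] smult_smult_assoc mult.commute)
  also have "Q\<^sup>T *\<^sub>v (e \<cdot>\<^sub>v col Q 0) = e \<cdot>\<^sub>v (Q\<^sup>T *\<^sub>v col Q 0)"
    using Q v(1) by (intro mult_mat_vec[of _ n n]) auto
  also have "Q\<^sup>T *\<^sub>v col Q 0 = col (Q\<^sup>T * Q) 0"
    using Q n by (intro col_mult2[symmetric, of _ n n _ n]) auto
  finally have colB: "col B 0 = e \<cdot>\<^sub>v col (1\<^sub>m n) 0" unfolding Q(2) .
  have Bi0: "B $$ (i, 0) = (if i = 0 then e else 0)" if "i < n" for i
    using arg_cong[OF colB, of "\<lambda>x. x $ i"] that B n by auto
  have B0i: "B $$ (0, i) = (if i = 0 then e else 0)" if "i < n" for i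
    using Bi0[OF that] arg_cong[OF Bsym, of "\<lambda>M. M $$ (0, i)"] B that n by auto
  \<comment> \<open>The 1 by 1 block is written as a list diagonal so that
    \<open>mat_diag_nth_append\<close> applies to \<open>[e] @ es\<close>.\<close>
  define E where "E = mat_diag (length [e]) ((!) [e])"
  define D where "D = mat m m (\<lambda>(i, j). B $$ (Suc i, Suc j))"
  have E: "E \<in> carrier_mat 1 1" and D: "D \<in> carrier_mat m m" by (auto simp: E_def D_def)
  have blk: "B = four_block_mat E (0\<^sub>m 1 m) (0\<^sub>m m 1) D"
  proof (rule eq_matI, goal_cases)
    case (1 i j)
    then have ij: "i < n" "j < n" using E D n by auto
    have dims: "dim_row E = 1" "dim_col E = 1" "dim_row D = m" "dim_col D = m"
      using E D by auto
    show ?case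
    proof (cases i)
      case 0
      then show ?thesis using ij n B0i[OF ij(2)]
        by (cases j) (simp_all add: dims, simp add: E_def mat_diag_def)
    next
      case (Suc i')
      then show ?thesis using ij n Bi0[OF ij(1)]
        by (cases j) (simp_all add: dims, simp add: D_def)
    qed
  qed (use B E D n in auto)
  have Bs: "B $$ (i, j) = B $$ (j, i)" if "i < n" "j < n" for i j
    using arg_cong[OF Bsym, of "\<lambda>M. M $$ (i, j)"] that B by auto
  have Dsym: "D\<^sup>T = D"
    by (rule eq_matI) (auto simp: D_def n intro!: Bs)
  have "char_poly E = [:- e, 1:]"
    by (subst char_poly_upper_triangular[OF E]) (auto simp: E_def mat_diag_def diag_mat_def)
  \<comment> \<open>Cancelling the common linear factor shows that \<open>D\<close> has exactly the
    remaining eigenvalues \<open>es\<close>.\<close>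
  then have "[:- e, 1:] * char_poly D = char_poly B"
    unfolding blk by (subst char_poly_four_block_zeros_col[OF E _ D]) auto
  also have "\<dots> = [:- e, 1:] * (\<Prod>e\<leftarrow>es. [:- e, 1:])"
    using char_poly_similar[OF simBA] Cons.prems(3) by simp
  finally have "char_poly D = (\<Prod>e\<leftarrow>es. [:- e, 1:])"
    by (subst (asm) mult_cancel_left) simp
  from Cons.IH[OF D Dsym this]
  have len: "length es = m" and sim: "similar_mat D (mat_diag m ((!) es))" by auto
  have "similar_mat B (mat_diag (length ([e] @ es)) ((!) ([e] @ es)))"
    unfolding mat_diag_nth_append unfolding blk E_def[symmetric] len
    using similar_mat_four_block_0_0[OF similar_mat_refl[OF E] sim E D] by simp
  then have "similar_mat A (mat_diag n ((!) (e # es)))"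
    using similar_mat_trans[OF similar_mat_sym[OF simBA]] len n by simp
  then show ?case using len n by simp
qed

section \<open>Roots of diagonal matrices\<close>

text \<open>A list is used because the block construction needs equal negative entries to be
  adjacent. The root itself may be non-diagonal.\<close>

definition diag_list_has_root :: "real list \<Rightarrow> bool" where
  "diag_list_has_root es \<longleftrightarrow>
    (\<exists>R \<in> carrier_mat (length es) (length es). R * R = mat_diag (length es) ((!) es))"

text \<open>Block diagonal matrices multiply block by block, so roots of the two parts combine into
  one.\<close>

lemma diag_list_has_root_append:
  assumes "diag_list_has_root xs" "diag_list_has_root ys"
  shows "diag_list_has_root (xs @ ys)"
proof -
  let ?k = "length xs" and ?l = "length ys"
  obtain R S where R: "R \<in> carrier_mat ?k ?k" "R * R = mat_diag ?k ((!) xs)"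
    and S: "S \<in> carrier_mat ?l ?l" "S * S = mat_diag ?l ((!) ys)"
    using assms unfolding diag_list_has_root_def by blast
  let ?M = "four_block_mat R (0\<^sub>m ?k ?l) (0\<^sub>m ?l ?k) S"
  have "?M * ?M = mat_diag (length (xs @ ys)) ((!) (xs @ ys))"
    unfolding mat_diag_nth_append R(2)[symmetric] S(2)[symmetric]
    using R(1) S(1)
    by (subst mult_four_block_mat[of _ ?k ?k _ ?l _ ?l _ _ ?k _ ?l]) auto
  moreover have "?M \<in> carrier_mat (length (xs @ ys)) (length (xs @ ys))"
    using R S by auto
  ultimately show ?thesis unfolding diag_list_has_root_def by blast
qed

lemma diag_list_has_root_single:
  assumes "x \<ge> 0"
  shows "diag_list_has_root [x]"
  unfolding diag_list_has_root_def
proof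
  let ?R = "mat_diag 1 (\<lambda>_. sqrt x)"
  show "?R * ?R = mat_diag (length [x]) ((!) [x])"
    unfolding mat_diag_diag using assms by (intro eq_matI) (auto simp: mat_diag_def)
qed simp

lemma diag_list_has_root_double:
  assumes "x < 0"
  shows "diag_list_has_root [x, x]"
  unfolding diag_list_has_root_def
proof
  \<comment> \<open>With s = \<open>sqrt (- x)\<close> the rows are (0, s) and (-s, 0). The diagonal
    entries of the square are -s * s = \<open>x\<close>, the others vanish.\<close>
  let ?R = "mat 2 2 (\<lambda>(i, j). if i = j then 0 else if i = 0 then sqrt (- x) else - sqrt (- x))"
  show "?R * ?R = mat_diag (length [x, x]) ((!) [x, x])"
    using assms
    by (intro eq_matI)
      (auto simp: mat_diag_def scalar_prod_def less_Suc_eq numeral_2_eq_2)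
qed (simp add: numeral_2_eq_2)

text \<open>Strong induction on the size: remove one nonnegative element or two copies of a negative
  one. Either removal preserves the parity condition.\<close>

lemma diag_list_has_root_exists_arrangement:
  assumes "\<And>x. x < 0 \<Longrightarrow> even (count M x)"
  shows "\<exists>es. mset es = M \<and> diag_list_has_root es"
  using assms
proof (induction M rule: measure_induct_rule[of size])
  case (less M)
  consider "M = {#}" | x where "x \<in># M" "x \<ge> 0" | x where "x \<in># M" "x < 0"
    by (meson multiset_nonemptyE not_le)
  then show ?case
  proof cases
    case 1
    have "diag_list_has_root []"
      unfolding diag_list_has_root_def by (rule bexI[of _ "1\<^sub>m 0"]) (auto simp: mat_diag_def)
    with 1 show ?thesis by (intro exI[of _ "[]"]) simp
  next
    case (2 x)
    obtain N where M: "M = add_mset x N" using 2 by (meson mset_add)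
    have "even (count N y)" if "y < 0" for y
      using less.prems[OF that] 2 that M by auto
    then obtain es where "mset es = N" "diag_list_has_root es"
      using less.IH[of N] M by auto
    then show ?thesis
      using diag_list_has_root_append[OF diag_list_has_root_single[OF 2(2)], of es] M
      by (intro exI[of _ "x # es"]) simp
  next
    case (3 x)
    obtain N' where M': "M = add_mset x N'" using 3 by (meson mset_add)
    \<comment> \<open>An odd count is nonzero, so a second copy of \<open>x\<close> is
      available.\<close>
    have "odd (count N' x)" using less.prems[OF 3(2)] M' by simp
    then have "x \<in># N'" by (metis count_eq_zero_iff even_zero)
    then obtain N where "N' = add_mset x N" by (meson mset_add)
    then have M: "M = add_mset x (add_mset x N)" using M' by simp
    have "even (count N y)" if "y < 0" for y
      using less.prems[OF that] M by (cases "y = x") auto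
    then obtain es where "mset es = N" "diag_list_has_root es"
      using less.IH[of N] M by auto
    then show ?thesis
      using diag_list_has_root_append[OF diag_list_has_root_double[OF 3(2)], of es] M
      by (intro exI[of _ "x # x # es"]) simp
  qed
qed

section \<open>Transfer of roots along similarity, and conclusion\<close>

text \<open>If A = P S S Q with Q P = 1, then P S Q squares to A.\<close>

lemma similar_mat_square_root:
  fixes A B S :: "'a :: comm_ring_1 mat"
  assumes "A \<in> carrier_mat n n" "S \<in> carrier_mat n n" "similar_mat A (S * S)"
  shows "\<exists>R \<in> carrier_mat n n. R * R = A"
proof -
  obtain P Q where "similar_mat_wit A (S * S) P Q"
    using assms(3) unfolding similar_mat_def by blast
  note w = similar_mat_witD2[OF assms(1) this]
  have "P * S * Q * (P * S * Q) = P * S * (Q * P) * S * Q"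
    using w(6,7) assms(2) by (simp add: assoc_mult_mat[of _ n n _ n _ n])
  also have "\<dots> = A"
    using w assms(2) by (simp add: assoc_mult_mat[of _ n n _ n _ n])
  finally show ?thesis using w assms(2) by (intro bexI[of _ "P * S * Q"]) auto
qed

theorem theorem2p6:
  fixes A :: "real mat" and n :: nat
  assumes "A \<in> carrier_mat n n"
    and "transpose_mat A = A"
    and "\<forall>x. eigenvalue A x \<and> x < 0 \<longrightarrow> even (count_list (eigenvalue_list A) x)"
  shows "\<exists>R \<in> carrier_mat n n. matrix_root R A"
proof -
  note A = assms(1)
  obtain as where as: "char_poly A = (\<Prod>a\<leftarrow>as. [:- a, 1:])"
    using real_symmetric_char_poly_splits[OF A assms(2)] by blast
  \<comment> \<open>The hypothesis speaks only of eigenvalues; any other number occurs zero times,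
    which is even. For eigenvalues, \<open>as\<close> and \<open>eigenvalue_list A\<close> are
    compared through root multiplicities, since their orders may differ.\<close>
  have "even (count (mset as) x)" if "x < 0" for x
  proof (cases "eigenvalue A x")
    case True
    have "proots (char_poly A) = mset as"
      unfolding as 
      by (induction as) (simp_all add: proots_mult prod_list_zero_iff image_iff del: mult_pCons_left)
    moreover have "char_poly A \<noteq> 0" using degree_monic_char_poly[OF A] by auto
    ultimately have "count (mset as) x = count_list (eigenvalue_list A) x"
      by (metis count_list_eigenvalue_list[OF A] count_proots)
    then show ?thesis using assms(3) True that by simp
  next
    case False
    then have "x \<notin> set as"
      unfolding eigenvalue_root_char_poly[OF A] as by (induction as) auto
    then show ?thesis by (simp add: count_mset)
  qed
  then obtain es where es: "mset es = mset as" "diag_list_has_root es"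
    using diag_list_has_root_exists_arrangement by blast
  \<comment> \<open>Reordering the linear factors does not change their product, so the paired list
    can be used for the diagonalization.\<close>
  have "char_poly A = (\<Prod>e\<leftarrow>es. [:- e, 1:])"
    unfolding as by (metis es(1) mset_map prod_mset_prod_list)
  from real_symmetric_similar_diag[OF A assms(2) this]
  have len: "length es = n" and sim: "similar_mat A (mat_diag n ((!) es))" by auto
  obtain S where S: "S \<in> carrier_mat n n" "S * S = mat_diag n ((!) es)"
    using es(2) len unfolding diag_list_has_root_def by blast
  obtain R where R: "R \<in> carrier_mat n n" "R * R = A"
    using similar_mat_square_root[OF A S(1)] sim S(2) by auto
  then show ?thesis
    unfolding matrix_root_def by (intro bexI[of _ R]) (auto simp: numeral_2_eq_2)
qed

end
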